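(* Let $K$ be a field of characteristic $0$, let $L=\mathcal{L}(x,y)$ be the free Lie algebra over $K$ freely generated by $x,y$, let $\delta$ be the derivation of $L$ with $\delta(x)=0$, $\delta(y)=x$, and let $L^\delta=\{a\in L:\delta(a)=0\}$. Let $A,B$ be Hall monomials such that $M=[A,B]\neq 0$ and $M\in L^\delta$. Let $r,s\geq 1$ be the integers with $\delta^r(A)=0$, $\delta^{r-1}(A)\neq 0$, $\delta^s(B)=0$, $\delta^{s-1}(B)\neq 0$, and let $k=\min\{r,s\}$. Then $M\in U^{(k)}$. Moreover, if at least one of $A$ and $B$ belongs to $L^\delta$, then $M\in U^{(1)}$.
   Context: Hall monomials are the elements of the Hall basis of $L$ (basic words with respect to the degree-lexicographic order with $x<y$). For Hall monomials $A,B$ and integers $m,k\geq0$, the pseudodeterminant is $U^{(m,k)}_{A,B}=[\delta^m(A),\delta^{k}(B)]-[\delta^{k}(A),\delta^m(B)]$. For an integer $k\geq 1$, $U^{(k)}$ denotes the Lie subalgebra of $L^\delta$ generated by: (i) all constants of the form $[f,g]\in L^\delta$ ($f,g\in L$) for which there exist an integer $r\geq k$ and $\alpha\in K$ with $\delta^{r-1}(f)=\alpha\,\delta^{k-1}(g)\neq 0$; (ii) all pseudodeterminants $U^{(k,0)}_{A,B}$ ($A,B$ Hall monomials) that lie in $L^\delta$; and (iii) the element $x$. *)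

theory Defs
  imports Main
begin

text \<open>
Model of the free Lie algebra L(x,y) over a field K of characteristic 0:
L is realised as the Lie subalgebra of Lie polynomials inside the free associative
algebra K<x,y>.  An element of K<x,y> is a coefficient function on words over
the alphabet {x,y}; the letter x is encoded as False and y as True.
\<close>

type_synonym 'k ncpoly = "bool list \<Rightarrow> 'k"

definition nc_zero :: "'k::field ncpoly" where
  "nc_zero = (\<lambda>w. 0)"

definition nc_add :: "'k::field ncpoly \<Rightarrow> 'k ncpoly \<Rightarrow> 'k ncpoly" where
  "nc_add p q = (\<lambda>w. p w + q w)"

definition nc_diff :: "'k::field ncpoly \<Rightarrow> 'k ncpoly \<Rightarrow> 'k ncpoly" where
  "nc_diff p q = (\<lambda>w. p w - q w)"

definition nc_smult :: "'k::field \<Rightarrow> 'k ncpoly \<Rightarrow> 'k ncpoly" where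
  "nc_smult c p = (\<lambda>w. c * p w)"

definition nc_mult :: "'k::field ncpoly \<Rightarrow> 'k ncpoly \<Rightarrow> 'k ncpoly" where
  "nc_mult p q = (\<lambda>w. \<Sum>i\<le>length w. p (take i w) * q (drop i w))"

definition lbr :: "'k::field ncpoly \<Rightarrow> 'k ncpoly \<Rightarrow> 'k ncpoly" where
  "lbr p q = nc_diff (nc_mult p q) (nc_mult q p)"

definition gen_x :: "'k::field ncpoly" where
  "gen_x = (\<lambda>w. if w = [False] then 1 else 0)"

definition gen_y :: "'k::field ncpoly" where
  "gen_y = (\<lambda>w. if w = [True] then 1 else 0)"

inductive_set free_lie :: "'k::field ncpoly set" where
  gen_x: "gen_x \<in> free_lie"
| gen_y: "gen_y \<in> free_lie"
| add: "a \<in> free_lie \<Longrightarrow> b \<in> free_lie \<Longrightarrow> nc_add a b \<in> free_lie"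
| smult: "a \<in> free_lie \<Longrightarrow> nc_smult c a \<in> free_lie"
| br: "a \<in> free_lie \<Longrightarrow> b \<in> free_lie \<Longrightarrow> lbr a b \<in> free_lie"

text \<open>The derivation delta with delta(x) = 0, delta(y) = x, written out on K<x,y>:
 delta sends a word u to the sum of the words obtained by replacing one occurrence
 of y by x; hence the coefficient of w in delta(p) is the sum of the coefficients of p
 at the words obtained from w by replacing one occurrence of x by y.\<close>
definition delta :: "'k::field ncpoly \<Rightarrow> 'k ncpoly" where
  "delta p = (\<lambda>w. \<Sum>i\<in>{i. i < length w \<and> w ! i = False}. p (w[i := True]))"

definition lie_consts :: "'k::field ncpoly set" where
  "lie_consts = {a \<in> free_lie. delta a = nc_zero}"

datatype htree = Leaf bool | Node htree htree

fun foliage :: "htree \<Rightarrow> bool list" where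
  "foliage (Leaf b) = [b]"
| "foliage (Node u v) = foliage u @ foliage v"

definition hless :: "htree \<Rightarrow> htree \<Rightarrow> bool" where
  "hless s t \<longleftrightarrow> length (foliage s) < length (foliage t) \<or>
     (length (foliage s) = length (foliage t) \<and> ord_class.lexordp (foliage s) (foliage t))"

definition hle :: "htree \<Rightarrow> htree \<Rightarrow> bool" where
  "hle s t \<longleftrightarrow> s = t \<or> hless s t"

inductive_set hall_trees :: "htree set" where
  leaf: "Leaf b \<in> hall_trees"
| node: "u \<in> hall_trees \<Longrightarrow> v \<in> hall_trees \<Longrightarrow> hless v u \<Longrightarrow>
          (case u of Leaf _ \<Rightarrow> True | Node u1 u2 \<Rightarrow> hle u2 v) \<Longrightarrow> Node u v \<in> hall_trees"

fun heval :: "htree \<Rightarrow> 'k::field ncpoly" where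
  "heval (Leaf b) = (if b then gen_y else gen_x)"
| "heval (Node u v) = lbr (heval u) (heval v)"

definition hall_monomial :: "'k::field ncpoly \<Rightarrow> bool" where
  "hall_monomial a \<longleftrightarrow> (\<exists>t\<in>hall_trees. a = heval t)"

definition pseudodet :: "nat \<Rightarrow> nat \<Rightarrow> 'k::field ncpoly \<Rightarrow> 'k ncpoly \<Rightarrow> 'k ncpoly" where
  "pseudodet m k A B = nc_diff (lbr ((delta ^^ m) A) ((delta ^^ k) B))
                               (lbr ((delta ^^ k) A) ((delta ^^ m) B))"

inductive_set lie_gen :: "'k::field ncpoly set \<Rightarrow> 'k ncpoly set" for S where
  base: "a \<in> S \<Longrightarrow> a \<in> lie_gen S"
| zero: "nc_zero \<in> lie_gen S"
| add: "a \<in> lie_gen S \<Longrightarrow> b \<in> lie_gen S \<Longrightarrow> nc_add a b \<in> lie_gen S"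
| smult: "a \<in> lie_gen S \<Longrightarrow> nc_smult c a \<in> lie_gen S"
| br: "a \<in> lie_gen S \<Longrightarrow> b \<in> lie_gen S \<Longrightarrow> lbr a b \<in> lie_gen S"

definition U_gens :: "nat \<Rightarrow> 'k::field ncpoly set" where
  "U_gens k =
     {c. \<exists>f g. f \<in> free_lie \<and> g \<in> free_lie \<and> c = lbr f g \<and> c \<in> lie_consts \<and>
          (\<exists>r \<alpha>. r \<ge> k \<and> (delta ^^ (r - 1)) f = nc_smult \<alpha> ((delta ^^ (k - 1)) g) \<and>
                 (delta ^^ (r - 1)) f \<noteq> nc_zero)}
   \<union> {c. \<exists>A B. hall_monomial A \<and> hall_monomial B \<and> c = pseudodet k 0 A B \<and> c \<in> lie_consts}
   \<union> {gen_x}"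

definition U_alg :: "nat \<Rightarrow> 'k::field ncpoly set" where
  "U_alg k = lie_gen (U_gens k)"

end

theory Submission
  imports Defs
begin

text \<open>
Let \<open>A\<close>, \<open>B\<close> be bihomogeneous Lie elements with \<open>[A,B]\<close> a nonzero constant. Then one of them is
itself a constant, so that \<open>k = 1\<close>. Indeed, otherwise the last nonzero \<open>\<delta>\<close>-derivatives of \<open>A\<close> and \<open>B\<close>
commute by the Leibniz rule, hence have the same degree \<open>n\<close>; multiplication of elements of degree \<open>n\<close>
is the tensor product, and sorting the terms of
\<open>\<delta>A \<otimes> B - B \<otimes> \<delta>A + A \<otimes> \<delta>B - \<delta>B \<otimes> A = 0\<close> by the \<open>y\<close>-degree of the first factor gives a contradiction.
If exactly one of them, say \<open>A\<close>, is a constant, then \<open>[A, \<delta>B] = 0\<close>, so \<open>\<delta>B\<close> is a multiple of \<open>A\<close> and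
\<open>[B,A]\<close> is a generator of type (i) for \<open>k = 1\<close>; if both are constants, they lie in \<open>U_alg 1\<close> by
induction on the bracketing.

Homogeneous Lie elements \<open>P\<close>, \<open>Q\<close> that commute have the same degree: if their degrees are \<open>p < q\<close>,
then \<open>P\<^sup>q\<close> and \<open>Q\<^sup>p\<close> commute and have equal degree, hence are proportional. As \<open>P\<close> and \<open>Q\<close> are primitive
for the shuffle coproduct, the component of \<open>P\<^sup>q\<close> of degree \<open>p\<close> in the first factor is
\<open>q P \<otimes> P\<^sup>q\<^sup>-\<^sup>1\<close>, while that of \<open>Q\<^sup>p\<close> is zero.
\<close>

section \<open>The free associative algebra\<close>

lemma nc_mult_Nil [simp]: "nc_mult p q [] = p [] * q []"
  by (simp add: nc_mult_def)

text \<open>A word is cut either before its first letter or after it. The left quotient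
  \<open>\<lambda>w. p (a # w)\<close> then makes inductions on words possible.\<close>

lemma nc_mult_Cons:
  "nc_mult p q (a # w) = p [] * q (a # w) + nc_mult (\<lambda>w. p (a # w)) q w"
  by (simp add: nc_mult_def sum.atMost_Suc_shift del: sum.atMost_Suc)

lemma nc_mult_add_left: "nc_mult (nc_add p q) r = nc_add (nc_mult p r) (nc_mult q r)"
  by (rule ext) (simp add: nc_mult_def nc_add_def sum.distrib algebra_simps)

lemma nc_mult_add_right: "nc_mult r (nc_add p q) = nc_add (nc_mult r p) (nc_mult r q)"
  by (rule ext) (simp add: nc_mult_def nc_add_def sum.distrib algebra_simps)

lemma nc_mult_diff_left: "nc_mult (nc_diff p q) r = nc_diff (nc_mult p r) (nc_mult q r)"
  by (rule ext) (simp add: nc_mult_def nc_diff_def sum_subtractf algebra_simps)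

lemma nc_mult_smult_left: "nc_mult (nc_smult c p) q = nc_smult c (nc_mult p q)"
  by (rule ext) (simp add: nc_mult_def nc_smult_def sum_distrib_left algebra_simps)

lemma nc_mult_smult_right: "nc_mult p (nc_smult c q) = nc_smult c (nc_mult p q)"
  by (rule ext) (simp add: nc_mult_def nc_smult_def sum_distrib_left algebra_simps)

lemma nc_mult_zero_left [simp]: "nc_mult nc_zero q = nc_zero"
  by (rule ext) (simp add: nc_mult_def nc_zero_def)

lemma nc_mult_zero_right [simp]: "nc_mult q nc_zero = nc_zero"
  by (rule ext) (simp add: nc_mult_def nc_zero_def)

lemma nc_mult_assoc: "nc_mult (nc_mult p q) r = nc_mult p (nc_mult q r)"
proof (rule ext)
  fix w show "nc_mult (nc_mult p q) r w = nc_mult p (nc_mult q r) w"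
  proof (induction w arbitrary: p)
    case (Cons a w)
    have "(\<lambda>w. nc_mult p q (a # w))
        = nc_add (nc_smult (p []) (\<lambda>w. q (a # w))) (nc_mult (\<lambda>w. p (a # w)) q)"
      by (rule ext) (simp add: nc_mult_Cons nc_add_def nc_smult_def)
    then show ?case
      by (simp add: nc_mult_Cons[of "nc_mult p q"] nc_mult_add_left nc_mult_smult_left)
         (simp add: nc_mult_Cons nc_add_def nc_smult_def Cons.IH algebra_simps)
  qed (simp add: mult.assoc)
qed

lemma nc_smult_eq_zero_iff: "nc_smult c p = nc_zero \<longleftrightarrow> c = 0 \<or> p = nc_zero"
  by (auto simp: nc_smult_def nc_zero_def fun_eq_iff)

lemma lbr_self [simp]: "lbr p p = nc_zero"
  by (simp add: lbr_def nc_diff_def nc_zero_def)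

lemma lbr_smult_left: "lbr (nc_smult c p) q = nc_smult c (lbr p q)"
  by (rule ext)
     (simp add: lbr_def nc_mult_smult_left nc_mult_smult_right,
      simp add: nc_diff_def nc_smult_def algebra_simps)

lemma lbr_zero_left [simp]: "lbr nc_zero q = nc_zero"
  by (simp add: lbr_def) (simp add: nc_diff_def nc_zero_def)

lemma lbr_zero_right [simp]: "lbr q nc_zero = nc_zero"
  by (simp add: lbr_def) (simp add: nc_diff_def nc_zero_def)

lemma lbr_swap: "lbr p q = nc_smult (-1) (lbr q p)"
  by (rule ext) (simp add: lbr_def nc_diff_def nc_smult_def)

lemma lbr_eq_zero_iff: "lbr p q = nc_zero \<longleftrightarrow> nc_mult p q = nc_mult q p"
  by (auto simp: lbr_def nc_diff_def nc_zero_def fun_eq_iff)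

section \<open>Unit element and powers\<close>

definition nc_one :: "'k::field ncpoly" where
  "nc_one = (\<lambda>w. if w = [] then 1 else 0)"

lemma nc_mult_one_left [simp]: "nc_mult nc_one p = p"
proof (rule ext)
  fix w show "nc_mult nc_one p w = p w"
    by (cases w) (simp_all add: nc_mult_Cons nc_one_def, simp add: nc_mult_def)
qed

lemma nc_mult_one_right [simp]: "nc_mult p nc_one = p"
proof (rule ext)
  fix w show "nc_mult p nc_one w = p w"
    by (induction w arbitrary: p) (simp_all add: nc_mult_Cons, simp_all add: nc_one_def)
qed

primrec nc_pow :: "'k::field ncpoly \<Rightarrow> nat \<Rightarrow> 'k ncpoly" where
  "nc_pow p 0 = nc_one"
| "nc_pow p (Suc n) = nc_mult p (nc_pow p n)"

lemma nc_pow_commute: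
  assumes "nc_mult p q = nc_mult q p"
  shows "nc_mult (nc_pow p n) q = nc_mult q (nc_pow p n)"
  by (induction n) (simp_all add: nc_mult_assoc, metis assms nc_mult_assoc)

section \<open>Homogeneous elements\<close>

text \<open>A condition on the support, so that zero is homogeneous of every degree and no bracket
  or derivative has to be checked for vanishing.\<close>

definition homog :: "nat \<Rightarrow> 'k::field ncpoly \<Rightarrow> bool" where
  "homog n p \<longleftrightarrow> (\<forall>w. p w \<noteq> 0 \<longrightarrow> length w = n)"

definition y_homog :: "nat \<Rightarrow> 'k::field ncpoly \<Rightarrow> bool" where
  "y_homog a p \<longleftrightarrow> (\<forall>w. p w \<noteq> 0 \<longrightarrow> count_list w True = a)"

lemma nc_mult_nonzeroE:
  assumes "nc_mult p q w \<noteq> 0"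
  obtains u v where "w = u @ v" "p u \<noteq> 0" "q v \<noteq> 0"
proof -
  obtain i where "p (take i w) * q (drop i w) \<noteq> 0"
    using assms unfolding nc_mult_def by (meson sum.neutral)
  then show thesis using that[of "take i w" "drop i w"] by auto
qed

lemma homog_mult: "homog m p \<Longrightarrow> homog n q \<Longrightarrow> homog (m + n) (nc_mult p q)"
  unfolding homog_def by (auto elim!: nc_mult_nonzeroE)

lemma y_homog_mult: "y_homog m p \<Longrightarrow> y_homog n q \<Longrightarrow> y_homog (m + n) (nc_mult p q)"
  unfolding y_homog_def by (auto elim!: nc_mult_nonzeroE)

lemma homog_pow: "homog n p \<Longrightarrow> homog (m * n) (nc_pow p m)"
  by (induction m) (simp_all add: homog_mult, simp add: homog_def nc_one_def)

lemma homog_lbr: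
  assumes "homog m p" "homog n q" shows "homog (m + n) (lbr p q)"
  using homog_mult[OF assms] homog_mult[OF assms(2,1)]
  unfolding homog_def lbr_def nc_diff_def by (metis add.commute diff_0_right)

lemma y_homog_lbr:
  assumes "y_homog m p" "y_homog n q" shows "y_homog (m + n) (lbr p q)"
  using y_homog_mult[OF assms] y_homog_mult[OF assms(2,1)]
  unfolding y_homog_def lbr_def nc_diff_def by (metis add.commute diff_0_right)

text \<open>Only the cut after \<open>n\<close> letters meets the support of \<open>p\<close>; thus
  the product is the tensor product.\<close>

lemma nc_mult_append:
  assumes "homog n p" "length u = n"
  shows "nc_mult p q (u @ v) = p u * q v"
proof -
  have "nc_mult p q (u @ v) = (\<Sum>i\<le>length (u @ v). if i = n then p u * q v else 0)"
    unfolding nc_mult_def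
  proof (rule sum.cong)
    fix i assume "i \<in> {..length (u @ v)}"
    then have "length (take i (u @ v)) = i" by simp
    then have "p (take i (u @ v)) = 0" if "i \<noteq> n"
      using assms(1) that unfolding homog_def by metis
    then show "p (take i (u @ v)) * q (drop i (u @ v)) = (if i = n then p u * q v else 0)"
      using assms(2) by auto
  qed simp
  then show ?thesis using assms(2) by simp
qed

lemma nc_mult_short:
  assumes "homog n p" "length w < n" shows "nc_mult p q w = 0"
  using assms by (auto simp: homog_def elim!: nc_mult_nonzeroE intro: ccontr)

lemma nc_mult_nonzero:
  assumes "homog n p" "p \<noteq> nc_zero" "q \<noteq> nc_zero"
  shows "nc_mult p q \<noteq> nc_zero"
proof -
  obtain u v where "p u \<noteq> 0" "q v \<noteq> 0"
    using assms(2,3) by (auto simp: nc_zero_def fun_eq_iff)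
  then have "nc_mult p q (u @ v) \<noteq> 0"
    using nc_mult_append[OF assms(1)] assms(1) by (simp add: homog_def)
  then show ?thesis by (metis nc_zero_def)
qed

lemma nc_pow_nonzero: "homog n p \<Longrightarrow> p \<noteq> nc_zero \<Longrightarrow> nc_pow p m \<noteq> nc_zero"
  by (induction m) (simp_all add: nc_mult_nonzero, auto simp: nc_one_def nc_zero_def fun_eq_iff)

lemma proportional_if_tensor_eq:
  assumes "homog n p" "homog n q" "s \<noteq> nc_zero" "homog n s"
    \<comment> \<open>The hypothesis reads \<open>p\<close> \<otimes> \<open>s\<close> =
      \<open>q\<close> \<otimes> \<open>t\<close>; evaluating the second factor at a word where
      \<open>s\<close> is nonzero leaves a scalar relation.\<close>
    and "\<And>u v. length u = n \<Longrightarrow> length v = n \<Longrightarrow> p u * s v = q u * t v"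
  shows "\<exists>c. p = nc_smult c q"
proof -
  obtain v where v: "s v \<noteq> 0" using assms(3) by (auto simp: nc_zero_def fun_eq_iff)
  then have lv: "length v = n" using assms(4) by (simp add: homog_def)
  have "p u = t v / s v * q u" for u
  proof (cases "length u = n")
    case True
    then show ?thesis using assms(5)[OF True lv] v by (simp add: field_simps)
  next
    case False
    then have "p u = 0" "q u = 0" using assms(1,2) unfolding homog_def by blast+
    then show ?thesis by simp
  qed
  then show ?thesis unfolding nc_smult_def by blast
qed

lemma commuting_same_degree_proportional:
  assumes "homog n p" "homog n q" "q \<noteq> nc_zero" "nc_mult p q = nc_mult q p"
  shows "\<exists>c. p = nc_smult c q"
proof (rule proportional_if_tensor_eq[OF assms(1,2,3,2)])
  fix u v :: "bool list" assume "length u = n" "length v = n"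
  then show "p u * q v = q u * p v"
    using nc_mult_append[OF assms(1), of u q v] nc_mult_append[OF assms(2), of u p v] assms(4)
    by simp
qed

section \<open>The shuffle coproduct\<close>

text \<open>\<open>shuffle_coprod p u v\<close> is the sum of \<open>p\<close> over all shuffles of \<open>u\<close> and \<open>v\<close>, counted with
multiplicity, that is, the coefficient of \<open>u \<otimes> v\<close> in the coproduct of \<open>p\<close>.\<close>

fun shuffle_coprod :: "'k::field ncpoly \<Rightarrow> bool list \<Rightarrow> bool list \<Rightarrow> 'k" where
  "shuffle_coprod p [] v = p v"
| "shuffle_coprod p (a # u) [] = p (a # u)"
| "shuffle_coprod p (a # u) (b # v) =
     shuffle_coprod (\<lambda>w. p (a # w)) u (b # v) + shuffle_coprod (\<lambda>w. p (b # w)) (a # u) v"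

lemma shuffle_coprod_Nil_right [simp]: "shuffle_coprod p u [] = p u"
  by (cases u) simp_all

lemma shuffle_coprod_zero [simp]: "shuffle_coprod (\<lambda>w. 0) u v = 0"
  by (induction "\<lambda>w::bool list. 0::'a" u v rule: shuffle_coprod.induct) simp_all

lemma shuffle_coprod_add:
  "shuffle_coprod (nc_add p q) u v = shuffle_coprod p u v + shuffle_coprod q u v"
  by (induction p u v arbitrary: q rule: shuffle_coprod.induct) (simp_all add: nc_add_def)

lemma shuffle_coprod_smult:
  "shuffle_coprod (nc_smult c p) u v = c * shuffle_coprod p u v"
  by (induction p u v rule: shuffle_coprod.induct) (simp_all add: nc_smult_def algebra_simps)

lemma shuffle_coprod_diff:
  "shuffle_coprod (nc_diff p q) u v = shuffle_coprod p u v - shuffle_coprod q u v"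
  by (induction p u v arbitrary: q rule: shuffle_coprod.induct) (simp_all add: nc_diff_def)

text \<open>Left multiplication of the tensor \<open>F\<close> by \<open>p\<close> \<otimes> 1 + 1
  \<otimes> \<open>p\<close>.\<close>

definition prim_mult ::
  "'k::field ncpoly \<Rightarrow> (bool list \<Rightarrow> bool list \<Rightarrow> 'k) \<Rightarrow> bool list \<Rightarrow> bool list \<Rightarrow> 'k" where
  "prim_mult p F u v = nc_mult p (\<lambda>u. F u v) u + nc_mult p (F u) v"

text \<open>Multiplications on different tensor factors commute, so the mixed terms of the
  commutator cancel.\<close>

lemma prim_mult_lbr:
  "prim_mult (lbr p q) F u v
     = prim_mult p (prim_mult q F) u v - prim_mult q (prim_mult p F) u v"
proof -
  have swap: "nc_mult p (\<lambda>u. nc_mult q (F u) v) u = nc_mult q (\<lambda>v. nc_mult p (\<lambda>u. F u v) u) v"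
    for p q
    unfolding nc_mult_def sum_distrib_left by (subst sum.swap) (simp add: algebra_simps)
  have exp: "prim_mult p (prim_mult q F) u v
      = nc_mult (nc_mult p q) (\<lambda>u. F u v) u + nc_mult (nc_mult p q) (F u) v
        + nc_mult p (\<lambda>u. nc_mult q (F u) v) u + nc_mult p (\<lambda>v. nc_mult q (\<lambda>u. F u v) u) v" for p q
    using nc_mult_add_right[of p "nc_mult q (\<lambda>u. F u v)" "\<lambda>u. nc_mult q (F u) v"]
      nc_mult_add_right[of p "\<lambda>v. nc_mult q (\<lambda>u. F u v) u" "nc_mult q (F u)"]
    by (simp add: prim_mult_def[abs_def] nc_add_def nc_mult_assoc)
  show ?thesis
    unfolding exp swap[of p q] swap[of q p]
    by (simp add: prim_mult_def lbr_def nc_mult_diff_left) (simp add: nc_diff_def)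
qed

text \<open>The first letter of a shuffle comes from \<open>u\<close> or from \<open>v\<close>, and
  it has to be \<open>z\<close>.\<close>

lemma shuffle_coprod_letter_mult:
  assumes p: "p = (\<lambda>w. if w = [z] then 1 else 0)"
  shows "shuffle_coprod (nc_mult p r) u v = prim_mult p (shuffle_coprod r) u v"
proof -
  have Cons: "nc_mult p q (a # w) = (if a = z then q w else 0)" for q :: "'a ncpoly" and a w
  proof -
    have "(\<lambda>w. p (a # w)) = (if a = z then nc_one else nc_zero)"
      by (rule ext) (simp add: p nc_one_def nc_zero_def)
    then show ?thesis by (simp add: nc_mult_Cons p) (simp add: nc_zero_def)
  qed
  have Nil: "p [] = 0" by (simp add: p)
  show ?thesis
    by (cases u; cases v) (simp_all add: prim_mult_def Cons Nil)
qed

text \<open>Lie elements are primitive; the additional factor \<open>r\<close> makes the induction go through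
without knowing that the coproduct is multiplicative in general.\<close>

lemma shuffle_coprod_lie_mult:
  "p \<in> free_lie \<Longrightarrow> shuffle_coprod (nc_mult p r) u v = prim_mult p (shuffle_coprod r) u v"
proof (induction p arbitrary: r u v rule: free_lie.induct)
  case (add a b)
  then show ?case
    by (simp add: nc_mult_add_left shuffle_coprod_add prim_mult_def) (simp add: nc_add_def)
next
  case (smult a c)
  then show ?case
    by (simp add: nc_mult_smult_left shuffle_coprod_smult prim_mult_def)
       (simp add: nc_smult_def algebra_simps)
next
  case (br a b)
  have "shuffle_coprod (nc_mult b r) = prim_mult b (shuffle_coprod r)"
    "shuffle_coprod (nc_mult a r) = prim_mult a (shuffle_coprod r)"
    using br.IH by blast+
  moreover have "nc_mult (lbr a b) r = nc_diff (nc_mult a (nc_mult b r)) (nc_mult b (nc_mult a r))"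
    by (simp add: lbr_def nc_mult_diff_left nc_mult_assoc)
  ultimately show ?case
    by (simp add: prim_mult_lbr shuffle_coprod_diff br.IH)
qed (simp_all add: gen_x_def gen_y_def shuffle_coprod_letter_mult)

lemma nc_mult_eq_0_right: "(\<And>w. q w = 0) \<Longrightarrow> nc_mult p q w = 0"
  by (simp add: nc_mult_def)

lemma shuffle_coprod_one: "u \<noteq> [] \<Longrightarrow> shuffle_coprod nc_one u v = 0"
  by (cases u; cases v) (simp_all add: nc_one_def)

text \<open>Each factor \<open>p\<close> goes wholly to one side. The word \<open>u\<close> is too
  short to receive one, and it is nonempty, so it cannot receive none.\<close>

lemma shuffle_coprod_pow_low:
  assumes "p \<in> free_lie" "homog n p" "u \<noteq> []" "length u < n"
  shows "shuffle_coprod (nc_pow p m) u v = 0"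
proof (induction m arbitrary: v)
  case 0
  then show ?case using assms(3) by (simp add: shuffle_coprod_one)
next
  case (Suc m)
  then show ?case
    by (simp add: shuffle_coprod_lie_mult[OF assms(1)] prim_mult_def nc_mult_short[OF assms(2,4)]
        nc_mult_eq_0_right)
qed

text \<open>Exactly one of the \<open>Suc m\<close> factors goes to the left; the coefficient counts
  the choices.\<close>

lemma shuffle_coprod_pow:
  assumes "p \<in> free_lie" "homog n p" "length u = n" "n > 0"
  shows "shuffle_coprod (nc_pow p (Suc m)) u v = of_nat (Suc m) * p u * nc_pow p m v"
proof -
  have mult_u: "nc_mult p F u = p u * F []" for F
    using nc_mult_append[OF assms(2,3), of F "[]"] by simp
  show ?thesis
  proof (induction m arbitrary: v)
    case 0
    have "u \<noteq> []" using assms by auto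
    then show ?case
      using shuffle_coprod_lie_mult[OF assms(1), of nc_one u v]
      by (simp add: prim_mult_def mult_u shuffle_coprod_one nc_mult_eq_0_right)
  next
    case (Suc m)
    have "shuffle_coprod (nc_pow p (Suc m)) u = nc_smult (of_nat (Suc m) * p u) (nc_pow p m)"
      by (rule ext) (simp only: Suc nc_smult_def)
    then have "shuffle_coprod (nc_mult p (nc_pow p (Suc m))) u v
        = p u * nc_pow p (Suc m) v + of_nat (Suc m) * p u * nc_pow p (Suc m) v"
      unfolding shuffle_coprod_lie_mult[OF assms(1)] prim_mult_def
      by (simp only: mult_u nc_mult_smult_right nc_pow.simps shuffle_coprod.simps)
         (simp only: nc_smult_def)
    then show ?case by (simp add: algebra_simps)
  qed
qed

lemma free_lie_Nil: "p \<in> free_lie \<Longrightarrow> p [] = 0"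
  by (induction rule: free_lie.induct)
     (simp_all add: gen_x_def gen_y_def nc_add_def nc_smult_def lbr_def nc_diff_def)

section \<open>Degrees of commuting Lie elements\<close>

lemma commuting_lie_degree_not_less:
  fixes p q :: "'k::field_char_0 ncpoly"
  assumes "p \<in> free_lie" "q \<in> free_lie" "homog m p" "homog n q"
    and "p \<noteq> nc_zero" "q \<noteq> nc_zero" "nc_mult p q = nc_mult q p"
  shows "\<not> m < n"
proof
  assume "m < n"
  obtain u where u: "p u \<noteq> 0" using assms(5) by (auto simp: nc_zero_def fun_eq_iff)
  then have lu: "length u = m" using assms(3) by (simp add: homog_def)
  have "u \<noteq> []" using u free_lie_Nil[OF assms(1)] by auto
  with lu have "m > 0" by auto
  obtain k where k: "n = Suc k" using \<open>m < n\<close> by (cases n) auto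
  have "nc_mult (nc_pow p n) (nc_pow q m) = nc_mult (nc_pow q m) (nc_pow p n)"
    by (metis assms(7) nc_pow_commute)
  moreover have "homog (n * m) (nc_pow p n)" "homog (n * m) (nc_pow q m)"
    using homog_pow[OF assms(3), of n] homog_pow[OF assms(4), of m] by (simp_all add: mult.commute)
  ultimately obtain c where c: "nc_pow p n = nc_smult c (nc_pow q m)"
    using commuting_same_degree_proportional nc_pow_nonzero[OF assms(4,6)] by blast
  obtain v where v: "nc_pow p k v \<noteq> 0"
    using nc_pow_nonzero[OF assms(3,5), of k] by (auto simp: nc_zero_def fun_eq_iff)
  \<comment> \<open>The length of \<open>u\<close> lies strictly between 0 and \<open>n\<close>,
    where powers of \<open>q\<close> have no component.\<close>
  have "shuffle_coprod (nc_pow p n) u v = 0"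
    unfolding c shuffle_coprod_smult
    using shuffle_coprod_pow_low[OF assms(2,4) \<open>u \<noteq> []\<close>] lu \<open>m < n\<close> by simp
  \<comment> \<open>Characteristic 0 keeps the factor \<open>of_nat (Suc k)\<close> nonzero.\<close>
  moreover have "shuffle_coprod (nc_pow p n) u v \<noteq> 0"
    unfolding k shuffle_coprod_pow[OF assms(1,3) lu \<open>m > 0\<close>] using u v
    by (simp del: of_nat_Suc)
  ultimately show False by simp
qed

lemma commuting_lie_degree_eq:
  fixes p q :: "'k::field_char_0 ncpoly"
  assumes "p \<in> free_lie" "q \<in> free_lie" "homog m p" "homog n q"
    and "p \<noteq> nc_zero" "q \<noteq> nc_zero" "lbr p q = nc_zero"
  shows "m = n"
  using commuting_lie_degree_not_less[of p q m n] commuting_lie_degree_not_less[of q p n m] assms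
  by (auto simp: lbr_eq_zero_iff)

lemma commuting_lie_proportional:
  fixes p q :: "'k::field_char_0 ncpoly"
  assumes "p \<in> free_lie" "q \<in> free_lie" "homog m p" "homog n q"
    and "p \<noteq> nc_zero" "q \<noteq> nc_zero" "lbr p q = nc_zero"
  shows "\<exists>c. p = nc_smult c q"
  using commuting_lie_degree_eq[OF assms] commuting_same_degree_proportional[of n p q] assms
  by (auto simp: lbr_eq_zero_iff)

section \<open>The derivation\<close>

lemma delta_Nil [simp]: "delta p [] = 0"
  by (simp add: delta_def)

lemma delta_Cons:
  "delta p (a # w) = (if a then 0 else p (True # w)) + delta (\<lambda>w. p (a # w)) w"
proof -
  let ?I = "{i. i < length w \<and> w ! i = False}"
  have eq: "{i. i < length (a # w) \<and> (a # w) ! i = False} = (if a then {} else {0}) \<union> Suc ` ?I"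
  proof (rule set_eqI)
    fix i show "i \<in> {i. i < length (a # w) \<and> (a # w) ! i = False}
        \<longleftrightarrow> i \<in> (if a then {} else {0}) \<union> Suc ` ?I"
      by (cases i) auto
  qed
  show ?thesis
    unfolding delta_def eq
    by (subst sum.union_disjoint) (auto simp: sum.reindex)
qed

lemma delta_add: "delta (nc_add p q) = nc_add (delta p) (delta q)"
  by (rule ext) (simp add: delta_def nc_add_def sum.distrib)

lemma delta_diff: "delta (nc_diff p q) = nc_diff (delta p) (delta q)"
  by (rule ext) (simp add: delta_def nc_diff_def sum_subtractf)

lemma delta_smult: "delta (nc_smult c p) = nc_smult c (delta p)"
  by (rule ext) (simp add: delta_def nc_smult_def sum_distrib_left)

lemma delta_zero [simp]: "delta nc_zero = nc_zero"
  by (rule ext) (simp add: delta_def nc_zero_def)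

lemma delta_pow_zero [simp]: "(delta ^^ n) nc_zero = nc_zero"
  by (induction n) simp_all

lemma delta_pow_add: "(delta ^^ n) (nc_add p q) = nc_add ((delta ^^ n) p) ((delta ^^ n) q)"
  by (induction n) (simp_all add: delta_add)

lemma delta_mult: "delta (nc_mult p q) = nc_add (nc_mult (delta p) q) (nc_mult p (delta q))"
proof (rule ext)
  fix w
  show "delta (nc_mult p q) w = nc_add (nc_mult (delta p) q) (nc_mult p (delta q)) w"
  proof (induction w arbitrary: p)
    case Nil
    show ?case by (simp add: nc_add_def)
  next
    case (Cons a w)
    have mult: "(\<lambda>w. nc_mult p q (a # w))
        = nc_add (nc_smult (p []) (\<lambda>w. q (a # w))) (nc_mult (\<lambda>w. p (a # w)) q)"
      by (rule ext) (simp add: nc_mult_Cons nc_add_def nc_smult_def)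
    have del: "(\<lambda>w. delta p (a # w))
        = nc_add (if a then nc_zero else (\<lambda>w. p (True # w))) (delta (\<lambda>w. p (a # w)))"
      by (rule ext) (simp add: delta_Cons nc_add_def nc_zero_def)
    have "delta (nc_mult p q) (a # w)
        = (if a then 0 else nc_mult p q (True # w)) + p [] * delta (\<lambda>w. q (a # w)) w
          + nc_mult (delta (\<lambda>w. p (a # w))) q w + nc_mult (\<lambda>w. p (a # w)) (delta q) w"
      unfolding delta_Cons[of "nc_mult p q"] mult delta_add delta_smult
      by (simp add: nc_add_def nc_smult_def Cons.IH)
    moreover have "nc_mult (delta p) q (a # w)
        = (if a then 0 else nc_mult (\<lambda>w. p (True # w)) q w) + nc_mult (delta (\<lambda>w. p (a # w))) q w"
      unfolding nc_mult_Cons[of "delta p"] del nc_mult_add_left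
      by (simp add: nc_add_def) (simp add: nc_zero_def)
    ultimately show ?case
      by (simp add: nc_add_def nc_mult_Cons[of p] delta_Cons[of q] algebra_simps)
  qed
qed

lemma delta_lbr: "delta (lbr p q) = nc_add (lbr (delta p) q) (lbr p (delta q))"
  by (rule ext)
     (simp add: lbr_def delta_diff delta_mult, simp add: nc_add_def nc_diff_def)

lemma delta_gen_x: "delta gen_x = nc_zero"
proof (rule ext)
  fix w :: "bool list"
  \<comment> \<open>\<open>delta\<close> evaluates \<open>gen_x\<close> only at words in which some
    letter has been set to y.\<close>
  have "w[i := True] \<noteq> [False]" if "i < length w" for i
    using that by (cases w) (auto split: nat.splits)
  then show "delta gen_x w = nc_zero w" by (auto simp: delta_def gen_x_def nc_zero_def)
qed

lemma delta_gen_y: "delta gen_y = (gen_x :: 'k::field ncpoly)"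
proof (rule ext)
  fix w :: "bool list"
  show "delta gen_y w = (gen_x w :: 'k)"
  proof (cases w)
    case (Cons a v)
    have "delta (\<lambda>w. gen_y (a # w)) v = (0 :: 'k)"
      unfolding delta_def by (rule sum.neutral) (auto simp: gen_y_def)
    then show ?thesis
      by (simp only: Cons delta_Cons) (simp add: gen_x_def gen_y_def)
  qed (simp add: gen_x_def)
qed

lemma free_lie_zero: "nc_zero \<in> free_lie"
  using free_lie.smult[OF free_lie.gen_x, of 0] unfolding nc_smult_def nc_zero_def
  by (simp only: mult_zero_left)

lemma delta_free_lie: "p \<in> free_lie \<Longrightarrow> delta p \<in> free_lie"
  by (induction rule: free_lie.induct)
     (simp_all add: delta_gen_x delta_gen_y delta_add delta_smult delta_lbr
       free_lie_zero free_lie.intros)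

lemma delta_pow_free_lie: "p \<in> free_lie \<Longrightarrow> (delta ^^ n) p \<in> free_lie"
  by (induction n) (simp_all add: delta_free_lie)

section \<open>Degrees and nilpotency under the derivation\<close>

lemma delta_nonzeroE:
  assumes "delta p w \<noteq> 0"
  obtains i where "i < length w" "\<not> w ! i" "p (w[i := True]) \<noteq> 0"
proof -
  have "\<exists>i\<in>{i. i < length w \<and> w ! i = False}. p (w[i := True]) \<noteq> 0"
  proof (rule ccontr)
    assume "\<not> ?thesis"
    then have "delta p w = 0" unfolding delta_def by (intro sum.neutral) blast
    with assms show False ..
  qed
  then show thesis using that by auto
qed

lemma homog_delta: "homog n p \<Longrightarrow> homog n (delta p)"
  unfolding homog_def by (force elim: delta_nonzeroE)

lemma homog_delta_pow: "homog n p \<Longrightarrow> homog n ((delta ^^ m) p)"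
  by (induction m) (simp_all add: homog_delta)

lemma count_list_update_True:
  "i < length w \<Longrightarrow> \<not> w ! i \<Longrightarrow> count_list (w[i := True]) True = Suc (count_list w True)"
  by (induction w arbitrary: i) (auto split: nat.splits simp: nth_Cons)

lemma delta_pow_y_count:
  assumes "y_homog a p" "(delta ^^ n) p w \<noteq> 0" shows "count_list w True + n = a"
  using assms(2)
proof (induction n arbitrary: w)
  case 0
  then show ?case using assms(1) by (simp add: y_homog_def)
next
  case (Suc n)
  then obtain i where "i < length w" "\<not> w ! i" "(delta ^^ n) p (w[i := True]) \<noteq> 0"
    by (auto elim: delta_nonzeroE)
  then show ?case using Suc.IH[of "w[i := True]"] count_list_update_True[of i w] by simp
qed

text \<open>Each application lowers the y-degree by one, and \<open>Suc a\<close> of them would make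
  it negative.\<close>

lemma delta_pow_nilpotent:
  assumes "y_homog a p" shows "(delta ^^ Suc a) p = nc_zero"
proof (rule ext)
  fix w show "(delta ^^ Suc a) p w = nc_zero w"
    using delta_pow_y_count[OF assms, of "Suc a" w]
    by (cases "(delta ^^ Suc a) p w = 0") (simp_all add: nc_zero_def)
qed

lemma last_delta_pow:
  assumes "y_homog a p" "delta p \<noteq> nc_zero"
  obtains i where "(delta ^^ Suc i) p \<noteq> nc_zero" "(delta ^^ Suc (Suc i)) p = nc_zero"
proof -
  let ?P = "\<lambda>n. (delta ^^ n) p = nc_zero"
  define m where "m = (LEAST n. ?P n)"
  have m: "?P m" unfolding m_def by (rule LeastI[of ?P, OF delta_pow_nilpotent[OF assms(1)]])
  have min: "\<not> ?P n" if "n < m" for n using that not_less_Least unfolding m_def by blast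
  have "m \<noteq> 0" "m \<noteq> Suc 0" using m assms(2) delta_zero by (auto intro!: notI)
  then obtain i where "m = Suc (Suc i)" by (metis old.nat.exhaust)
  then show thesis using that[of i] m min[of "Suc i"] by simp
qed

text \<open>In the Leibniz expansion every other term differentiates \<open>p\<close> more than
  \<open>i\<close> times or \<open>q\<close> more than \<open>j\<close> times. The induction is
  Pascal's rule.\<close>

lemma delta_pow_lbr:
  assumes "(delta ^^ Suc i) p = nc_zero" "(delta ^^ Suc j) q = nc_zero"
  shows "(delta ^^ (i + j)) (lbr p q)
       = nc_smult (of_nat ((i + j) choose i)) (lbr ((delta ^^ i) p) ((delta ^^ j) q))"
  using assms
proof (induction "i + j" arbitrary: i j p q)
  case 0
  then show ?case by (simp add: nc_smult_def)
next
  case (Suc n)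
  have step: "(delta ^^ Suc n) (lbr p q)
      = nc_add ((delta ^^ n) (lbr (delta p) q)) ((delta ^^ n) (lbr p (delta q)))"
    by (simp only: funpow_Suc_right comp_apply delta_lbr delta_pow_add)
  \<comment> \<open>The case \<open>i = 0\<close> is separate: there \<open>delta p\<close>
    vanishes, whereas truncated subtraction would give the coefficient 1.\<close>
  have left: "(delta ^^ n) (lbr (delta p) q)
      = nc_smult (of_nat (if i = 0 then 0 else n choose (i - 1)))
          (lbr ((delta ^^ i) p) ((delta ^^ j) q))"
  proof (cases i)
    case 0
    then show ?thesis using Suc.prems(1) by simp (simp add: nc_smult_def nc_zero_def)
  next
    case (Suc i')
    then show ?thesis
      using Suc.hyps(1)[of i' j "delta p" q] \<open>Suc n = i + j\<close> Suc.prems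
      by (simp add: funpow_swap1)
  qed
  have right: "(delta ^^ n) (lbr p (delta q))
      = nc_smult (of_nat (if j = 0 then 0 else n choose i))
          (lbr ((delta ^^ i) p) ((delta ^^ j) q))"
  proof (cases j)
    case 0
    then show ?thesis using Suc.prems(2) by simp (simp add: nc_smult_def nc_zero_def)
  next
    case (Suc j')
    then show ?thesis
      using Suc.hyps(1)[of i j' p "delta q"] \<open>Suc n = i + j\<close> Suc.prems
      by (simp add: funpow_swap1)
  qed
  have "(if i = 0 then 0 else n choose (i - 1)) + (if j = 0 then 0 else n choose i)
      = Suc n choose i"
    using \<open>Suc n = i + j\<close> by (cases i; cases j) auto
  then have "nc_add (nc_smult (of_nat (if i = 0 then 0 else n choose (i - 1))) z)
      (nc_smult (of_nat (if j = 0 then 0 else n choose i)) z)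
      = nc_smult (of_nat (Suc n choose i)) z" for z :: "'a ncpoly"
    unfolding nc_add_def nc_smult_def by (metis distrib_right of_nat_add)
  then show ?case using step left right \<open>Suc n = i + j\<close> by simp
qed

section \<open>Constant brackets\<close>

lemma same_degree_lbr_const:
  assumes "homog n p" "homog n q" "y_homog a p" "y_homog b q"
    and "lbr p q \<noteq> nc_zero" "delta (lbr p q) = nc_zero"
  shows "delta p = nc_zero \<or> delta q = nc_zero"
proof (rule ccontr)
  assume "\<not> ?thesis"
  then have dp: "delta p \<noteq> nc_zero" and dq: "delta q \<noteq> nc_zero" by auto
  note hd = homog_delta[OF assms(1)] homog_delta[OF assms(2)]
  \<comment> \<open>This is the coefficient of \<open>u @ v\<close> in
    \<open>delta (lbr p q)\<close>.\<close>
  have tensor: "delta p u * q v - q u * delta p v + (p u * delta q v - delta q u * p v) = 0"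
    if "length u = n" "length v = n" for u v
    using fun_cong[OF assms(6), of "u @ v"] that
    unfolding delta_lbr
    by (simp add: nc_add_def lbr_def nc_diff_def nc_zero_def nc_mult_append[OF assms(1)]
        nc_mult_append[OF assms(2)] nc_mult_append[OF hd(1)] nc_mult_append[OF hd(2)])
  have cp: "p w \<noteq> 0 \<Longrightarrow> count_list w True = a" and cq: "q w \<noteq> 0 \<Longrightarrow> count_list w True = b"
    and cdp: "delta p w \<noteq> 0 \<Longrightarrow> Suc (count_list w True) = a"
    and cdq: "delta q w \<noteq> 0 \<Longrightarrow> Suc (count_list w True) = b" for w
    using delta_pow_y_count[OF assms(3), of 1 w] delta_pow_y_count[OF assms(4), of 1 w] assms(3,4)
    unfolding y_homog_def by auto
  have len: "length w = n" if "p w \<noteq> 0 \<or> q w \<noteq> 0 \<or> delta p w \<noteq> 0 \<or> delta q w \<noteq> 0" for w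
    using that assms(1,2) hd unfolding homog_def by blast
  show False
  proof (cases "a = b")
    case True
    \<comment> \<open>Words \<open>u\<close> of y-degree \<open>a\<close> kill the terms with
      \<open>delta\<close> on the first factor; on all others both sides vanish.\<close>
    have "p u * delta q v = q u * delta p v" if "length u = n" "length v = n" for u v
    proof (cases "p u = 0 \<and> q u = 0")
      case False
      then have "count_list u True = a" using cp cq True by blast
      then have "delta p u = 0" "delta q u = 0" using cdp cdq True by fastforce+
      then show ?thesis using tensor[OF that] by simp
    qed simp
    then obtain c where "p = nc_smult c q"
      using proportional_if_tensor_eq[OF assms(1,2) dq hd(2)] by blast
    then have "lbr p q = nc_zero"
      by (simp add: lbr_smult_left) (simp add: nc_smult_def nc_zero_def)
    with assms(5) show False ..
  next
    case False
    \<comment> \<open>At \<open>u\<close>, the term with \<open>p u\<close> can only be cancelled by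
      the one with \<open>delta q u\<close>, which forces \<open>b = Suc a\<close>; at
      \<open>u'\<close> the roles are exchanged.\<close>
    obtain u v u' v' where nz: "p u \<noteq> 0" "delta q v \<noteq> 0" "q u' \<noteq> 0" "delta p v' \<noteq> 0"
    proof -
      have "p \<noteq> nc_zero" "q \<noteq> nc_zero" using dp dq by auto
      then show thesis using that dp dq by (auto simp: nc_zero_def fun_eq_iff)
    qed
    have "delta p u = 0" "q u = 0" using cdp cp[OF nz(1)] cq False by fastforce+
    then have "delta q u \<noteq> 0" using tensor[of u v] nz len by auto
    then have "b = Suc a" using cdq cp[OF nz(1)] by metis
    have "p u' = 0" "delta q u' = 0" using cp cq[OF nz(3)] cdq False by fastforce+
    then have "delta p u' \<noteq> 0" using tensor[of u' v'] nz len by auto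
    then have "a = Suc b" using cdp cq[OF nz(3)] by metis
    with \<open>b = Suc a\<close> show False by simp
  qed
qed

lemma lbr_const_cases:
  fixes p q :: "'k::field_char_0 ncpoly"
  assumes "p \<in> free_lie" "q \<in> free_lie" "homog m p" "homog n q" "y_homog a p" "y_homog b q"
    and "lbr p q \<noteq> nc_zero" "delta (lbr p q) = nc_zero"
  shows "delta p = nc_zero \<or> delta q = nc_zero"
proof (rule ccontr)
  assume "\<not> ?thesis"
  then have nz: "delta p \<noteq> nc_zero" "delta q \<noteq> nc_zero" by auto
  obtain i where i: "(delta ^^ Suc i) p \<noteq> nc_zero" "(delta ^^ Suc (Suc i)) p = nc_zero"
    using last_delta_pow[OF assms(5) nz(1)] .
  obtain j where j: "(delta ^^ Suc j) q \<noteq> nc_zero" "(delta ^^ Suc (Suc j)) q = nc_zero"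
    using last_delta_pow[OF assms(6) nz(2)] .
  have "(delta ^^ (Suc i + Suc j)) (lbr p q) = (delta ^^ (i + Suc j)) (delta (lbr p q))"
    by (simp add: funpow_swap1)
  also have "\<dots> = nc_zero" by (simp only: assms(8) delta_pow_zero)
  finally have "nc_smult (of_nat ((Suc i + Suc j) choose Suc i))
      (lbr ((delta ^^ Suc i) p) ((delta ^^ Suc j) q)) = nc_zero"
    by (simp only: delta_pow_lbr[OF i(2) j(2)])
  \<comment> \<open>Characteristic 0 allows division by the binomial coefficient.\<close>
  moreover have "of_nat ((Suc i + Suc j) choose Suc i) \<noteq> (0 :: 'k)"
    unfolding of_nat_eq_0_iff by (simp only: binomial_eq_0_iff)
  ultimately have "lbr ((delta ^^ Suc i) p) ((delta ^^ Suc j) q) = nc_zero"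
    by (simp only: nc_smult_eq_zero_iff simp_thms)
  then have "m = n"
    by (rule commuting_lie_degree_eq[OF delta_pow_free_lie[OF assms(1)]
          delta_pow_free_lie[OF assms(2)] homog_delta_pow[OF assms(3)] homog_delta_pow[OF assms(4)]
          i(1) j(1)])
  then show False
    using same_degree_lbr_const[OF assms(3) _ assms(5-8)] assms(4) nz by simp
qed

lemma U_alg_1_generator:
  fixes p q :: "'k::field_char_0 ncpoly"
  assumes "p \<in> free_lie" "q \<in> free_lie" "homog m p" "homog n q"
    and "p \<noteq> nc_zero" "delta p = nc_zero" "delta q \<noteq> nc_zero" "delta (lbr q p) = nc_zero"
  shows "lbr q p \<in> U_alg 1"
proof -
  have comm: "lbr (delta q) p = nc_zero"
    using assms(8) unfolding delta_lbr assms(6) lbr_zero_right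
    by (simp add: nc_add_def nc_zero_def)
  obtain c where "delta q = nc_smult c p"
    using commuting_lie_proportional[OF delta_free_lie[OF assms(2)] assms(1)
        homog_delta[OF assms(4)] assms(3,7,5) comm] ..
  \<comment> \<open>Type (i) with \<open>k = 1\<close> compares \<open>delta q\<close> with
    \<open>p\<close> itself, hence \<open>r = 2\<close>.\<close>
  then have "\<exists>r \<alpha>. r \<ge> 1 \<and> (delta ^^ (r - 1)) q = nc_smult \<alpha> ((delta ^^ (1 - 1)) p)
      \<and> (delta ^^ (r - 1)) q \<noteq> nc_zero"
    using assms(7) by (intro exI[of _ 2] exI[of _ c]) simp
  moreover have "lbr q p \<in> lie_consts"
    using free_lie.br[OF assms(2,1)] assms(8) by (simp add: lie_consts_def)
  ultimately have "lbr q p \<in> U_gens 1"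
    using assms(1,2) unfolding U_gens_def by blast
  then show ?thesis unfolding U_alg_def by (rule lie_gen.base)
qed

lemma U_alg_lbr_swap: "lbr q p \<in> U_alg k \<Longrightarrow> lbr p q \<in> U_alg k"
  unfolding U_alg_def by (subst lbr_swap) (rule lie_gen.smult)

section \<open>Evaluated bracketings\<close>

lemma heval_free_lie: "heval t \<in> free_lie"
  by (induction t) (auto intro: free_lie.intros)

lemma homog_heval: "homog (length (foliage t)) (heval t)"
  by (induction t) (simp_all add: homog_lbr, simp add: homog_def gen_x_def gen_y_def)

lemma y_homog_heval: "y_homog (count_list (foliage t) True) (heval t)"
  by (induction t) (simp_all add: y_homog_lbr, simp add: y_homog_def gen_x_def gen_y_def)

lemma heval_lbr_const_cases:
  assumes "lbr (heval t) (heval t') \<noteq> (nc_zero :: 'k::field_char_0 ncpoly)"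
    and "delta (lbr (heval t) (heval t')) = (nc_zero :: 'k ncpoly)"
  shows "delta (heval t) = (nc_zero :: 'k ncpoly) \<or> delta (heval t') = (nc_zero :: 'k ncpoly)"
  by (rule lbr_const_cases[OF heval_free_lie heval_free_lie homog_heval homog_heval
        y_homog_heval y_homog_heval assms])

text \<open>Kept apart from the induction on trees because the theorem applies it directly to the
  two given monomials.\<close>

lemma heval_lbr_mem_U_alg_1:
  fixes t t' :: htree
  assumes "lbr (heval t) (heval t') \<noteq> (nc_zero :: 'k::field_char_0 ncpoly)"
    and const: "delta (lbr (heval t) (heval t')) = (nc_zero :: 'k ncpoly)"
    and IH: "\<And>s. s \<in> {t, t'} \<Longrightarrow> heval s \<noteq> (nc_zero :: 'k ncpoly)
      \<Longrightarrow> delta (heval s) = (nc_zero :: 'k ncpoly) \<Longrightarrow> heval s \<in> (U_alg 1 :: 'k ncpoly set)"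
  shows "lbr (heval t) (heval t') \<in> (U_alg 1 :: 'k ncpoly set)"
proof -
  let ?p = "heval t :: 'k ncpoly" and ?q = "heval t' :: 'k ncpoly"
  note gen = U_alg_1_generator[OF heval_free_lie heval_free_lie homog_heval homog_heval]
  have nz: "?p \<noteq> nc_zero" "?q \<noteq> nc_zero" using assms(1) by auto
  consider "delta ?p = nc_zero" "delta ?q = nc_zero"
    | "delta ?p = nc_zero" "delta ?q \<noteq> nc_zero" | "delta ?p \<noteq> nc_zero" "delta ?q = nc_zero"
    using heval_lbr_const_cases[OF assms(1,2)] by blast
  then show ?thesis
  proof cases
    case 1
    then show ?thesis using IH nz unfolding U_alg_def by (intro lie_gen.br) auto
  next
    case 2
    have "delta (lbr ?q ?p) = nc_zero"
      using const by (subst lbr_swap) (simp add: delta_smult, simp add: nc_smult_def nc_zero_def)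
    then show ?thesis by (rule U_alg_lbr_swap[OF gen[OF nz(1) 2]])
  next
    case 3
    show ?thesis by (rule gen[OF nz(2) 3(2,1) const])
  qed
qed

lemma heval_const_mem_U_alg_1:
  assumes "heval t \<noteq> (nc_zero :: 'k::field_char_0 ncpoly)" "delta (heval t) = (nc_zero :: 'k ncpoly)"
  shows "heval t \<in> (U_alg 1 :: 'k ncpoly set)"
  using assms
proof (induction t)
  case (Leaf b)
  \<comment> \<open>The leaf y is excluded: its derivative x is nonzero.\<close>
  have "gen_x [False] \<noteq> (nc_zero [False] :: 'k)" by (simp add: gen_x_def nc_zero_def)
  then have "gen_x \<noteq> (nc_zero :: 'k ncpoly)" by metis
  with Leaf have "\<not> b" by (auto simp: delta_gen_y)
  then show ?case by (auto simp: U_alg_def U_gens_def intro: lie_gen.base)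
next
  case (Node t t')
  then show ?case using heval_lbr_mem_U_alg_1[of t t'] by auto
qed

theorem theorem4p3:
  fixes A B :: "'k::field_char_0 ncpoly" and r s :: nat
  assumes "hall_monomial A" and "hall_monomial B"
    and "lbr A B \<noteq> nc_zero" and "lbr A B \<in> lie_consts"
    and "r \<ge> 1" and "(delta ^^ r) A = nc_zero" and "(delta ^^ (r - 1)) A \<noteq> nc_zero"
    and "s \<ge> 1" and "(delta ^^ s) B = nc_zero" and "(delta ^^ (s - 1)) B \<noteq> nc_zero"
  shows "lbr A B \<in> U_alg (min r s)
     \<and> ((A \<in> lie_consts \<or> B \<in> lie_consts) \<longrightarrow> lbr A B \<in> U_alg 1)"
proof -
  obtain t t' where A: "A = heval t" and B: "B = heval t'"
    using assms(1,2) unfolding hall_monomial_def by blast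
  have const: "delta (lbr A B) = nc_zero" using assms(4) by (simp add: lie_consts_def)
  have order: "n = 1" if "n \<ge> 1" "(delta ^^ (n - 1)) p \<noteq> nc_zero" "delta p = nc_zero"
    for n and p :: "'k ncpoly"
  proof (rule ccontr)
    assume "n \<noteq> 1"
    then obtain k where "n - 1 = Suc k" using \<open>n \<ge> 1\<close> by (cases "n - 1") auto
    with that(2,3) show False by (simp add: funpow_swap1)
  qed
  have "delta A = nc_zero \<or> delta B = nc_zero"
    using heval_lbr_const_cases assms(3) const unfolding A B by blast
  \<comment> \<open>A nonzero constant has nilpotency order 1, so both claims are about
    \<open>U_alg 1\<close>.\<close>
  then have "min r s = 1" using order assms(5,7,8,10) by (metis min.absorb1 min.absorb2)
  moreover have "lbr A B \<in> U_alg 1"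
    using heval_lbr_mem_U_alg_1 heval_const_mem_U_alg_1 assms(3) const unfolding A B by blast
  ultimately show ?thesis by simp
qed

end
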